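(* Let $X$ be a countably infinite set and let $I$ and $J$ be ideals on $X$. If $\mathcal C_I^{(1)}\subseteq\mathcal C_J^{(1)}$, then $J\subseteq\hat I$. If $I$ is not dense, then $\mathcal C_I\subseteq\mathcal C_{\hat I}$.
   Context: An ideal on $X$ means here a family $I$ of subsets of $X$ that is closed under subsets and finite unions, contains all finite subsets of $X$, contains at least one infinite set, and does not contain all subsets of $X$. For an ideal $I$, $\mathcal C_I$ denotes the set of all finitary operations $f:X^n\to X$ ($n\ge1$) such that $f[A^n]\in I$ for all $A\in I$, and $\mathcal C_I^{(1)}$ denotes the set of unary functions $X\to X$ belonging to $\mathcal C_I$. The regularization of $I$ is $\hat I=\{A\subseteq X:\text{ each infinite }B\subseteq A\text{ contains an infinite set }C\in I\}$. The ideal $I$ is dense if $\hat I$ is the full power set of $X$; if $I$ is not dense, then $\hat I$ is again an ideal, that is, a family of subsets of $X$ that is closed under subsets and finite unions, contains all finite subsets of $X$, contains at least one infinite set, and does not contain all subsets of $X$. *)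

theory Defs
  imports "HOL-Library.Countable_Set" "HOL-Library.FuncSet"
begin

definition ideal_on :: "'a set \<Rightarrow> 'a set set \<Rightarrow> bool" where
  "ideal_on X I \<longleftrightarrow>
     I \<subseteq> Pow X \<and>
     (\<forall>A\<in>I. \<forall>B. B \<subseteq> A \<longrightarrow> B \<in> I) \<and>
     (\<forall>A\<in>I. \<forall>B\<in>I. A \<union> B \<in> I) \<and>
     (\<forall>A. A \<subseteq> X \<and> finite A \<longrightarrow> A \<in> I) \<and>
     (\<exists>A\<in>I. infinite A) \<and>
     I \<noteq> Pow X"

text \<open>The power \<open>A\<^sup>n\<close>, realised as the extensional maps from \<open>{0, ..., n - 1}\<close> to \<open>A\<close>.\<close>

definition tuples :: "nat \<Rightarrow> 'a set \<Rightarrow> (nat \<Rightarrow> 'a) set" where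
  "tuples n A = ({..<n} \<rightarrow>\<^sub>E A)"

text \<open>A finitary operation is a pair of its arity and an extensional function. The arity is
  recorded explicitly because it cannot always be recovered from the function: the constant
  operations with value \<open>undefined\<close> of different arities are the same HOL function.\<close>

definition operations :: "'a set \<Rightarrow> (nat \<times> ((nat \<Rightarrow> 'a) \<Rightarrow> 'a)) set" where
  "operations X = {(n, f). 1 \<le> n \<and> f \<in> tuples n X \<rightarrow>\<^sub>E X}"

definition ideal_clone :: "'a set \<Rightarrow> 'a set set \<Rightarrow> (nat \<times> ((nat \<Rightarrow> 'a) \<Rightarrow> 'a)) set" where
  "ideal_clone X I = {(n, f) \<in> operations X. \<forall>A\<in>I. f ` tuples n A \<in> I}"

text \<open>A map \<open>g : X \<rightarrow> X\<close> is identified with the 1-ary operation sending the tuple \<open>t\<close> to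
  \<open>g (t 0)\<close>.\<close>

definition unary_operation :: "'a set \<Rightarrow> ('a \<Rightarrow> 'a) \<Rightarrow> nat \<times> ((nat \<Rightarrow> 'a) \<Rightarrow> 'a)" where
  "unary_operation X g = (1, \<lambda>t\<in>tuples 1 X. g (t 0))"

definition ideal_clone_unary :: "'a set \<Rightarrow> 'a set set \<Rightarrow> ('a \<Rightarrow> 'a) set" where
  "ideal_clone_unary X I = {g \<in> X \<rightarrow>\<^sub>E X. unary_operation X g \<in> ideal_clone X I}"

definition regularization :: "'a set \<Rightarrow> 'a set set \<Rightarrow> 'a set set" where
  "regularization X I =
     {A. A \<subseteq> X \<and> (\<forall>B. B \<subseteq> A \<and> infinite B \<longrightarrow> (\<exists>C\<in>I. C \<subseteq> B \<and> infinite C))}"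

definition dense_ideal :: "'a set \<Rightarrow> 'a set set \<Rightarrow> bool" where
  "dense_ideal X I \<longleftrightarrow> regularization X I = Pow X"

lemma image_tuples_1: "(\<lambda>t. g (t 0)) ` tuples 1 A = g ` A"
proof -
  have "\<exists>t\<in>tuples 1 A. t 0 = a" if "a \<in> A" for a
    using that by (intro bexI[of _ "\<lambda>i\<in>{..<1}. a"]) (auto simp: tuples_def)
  moreover have "t 0 \<in> A" if "t \<in> tuples 1 A" for t
    using that by (auto simp: tuples_def)
  ultimately show ?thesis
    by (force simp: image_iff)
qed

lemma mem_ideal_clone_unary_iff:
  assumes "I \<subseteq> Pow X"
  shows "g \<in> ideal_clone_unary X I \<longleftrightarrow> g \<in> X \<rightarrow>\<^sub>E X \<and> (\<forall>A\<in>I. g ` A \<in> I)"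
proof -
  have img: "(\<lambda>t\<in>tuples 1 X. g (t 0)) ` tuples 1 A = g ` A" if "A \<in> I" for A
  proof -
    have "tuples 1 A \<subseteq> tuples 1 X"
      using that assms by (auto simp: tuples_def intro!: PiE_mono)
    then have "(\<lambda>t\<in>tuples 1 X. g (t 0)) ` tuples 1 A = (\<lambda>t. g (t 0)) ` tuples 1 A"
      by (intro image_cong) auto
    then show ?thesis
      by (simp only: image_tuples_1)
  qed
  have "(\<lambda>t\<in>tuples 1 X. g (t 0)) \<in> tuples 1 X \<rightarrow>\<^sub>E X" if "g \<in> X \<rightarrow>\<^sub>E X"
    using that by (auto simp: tuples_def PiE_iff)
  then show ?thesis
    using img by (auto simp del: One_nat_def
        simp: ideal_clone_unary_def unary_operation_def ideal_clone_def operations_def)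
qed

end

theory Submission
  imports Defs
begin

text \<open>
  Call a set \<open>B\<close> \<^emph>\<open>orthogonal\<close> to \<open>I\<close> if it meets every member of \<open>I\<close> in a finite set. A subset
  of \<open>X\<close> lies outside the regularization of \<open>I\<close> exactly if it contains an infinite set orthogonal
  to \<open>I\<close>, and both claims follow from this.

  If \<open>J\<close> had a member outside the regularization, then \<open>J\<close> would contain an infinite set \<open>B\<close>
  orthogonal to \<open>I\<close>. A function that maps the countable set \<open>B\<close> onto \<open>X\<close> and is constant elsewhere
  takes members of \<open>I\<close> to finite sets, so it preserves \<open>I\<close>; but it sends \<open>B \<in> J\<close> to \<open>X \<notin> J\<close>, so it
  does not preserve \<open>J\<close> (\<open>unary_clone_mem_expanding_orthogonal\<close>).

  Now let \<open>f\<close> be an \<open>n\<close>-ary operation preserving \<open>I\<close>, let \<open>A\<close> be in the regularization and let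
  \<open>B \<subseteq> f[A\<^sup>n]\<close> be infinite. Choose one preimage tuple for each element of \<open>B\<close>. The entries of these
  tuples lie in \<open>A\<close>, hence one can thin out the infinite set of tuples, one coordinate after the
  other, until all entries of the remaining tuples lie in a single \<open>C \<in> I\<close>
  (\<open>infinite_tuples_concentrate\<close>). Their values under \<open>f\<close> then form an infinite subset of \<open>B\<close> that
  is contained in \<open>f[C\<^sup>n] \<in> I\<close>.
\<close>

lemma ideal_on_carrier: "ideal_on X I \<Longrightarrow> A \<in> I \<Longrightarrow> A \<subseteq> X"
  by (auto simp: ideal_on_def)

lemma ideal_on_subset: "ideal_on X I \<Longrightarrow> A \<in> I \<Longrightarrow> B \<subseteq> A \<Longrightarrow> B \<in> I"
  by (auto simp: ideal_on_def)

lemma ideal_on_Un: "ideal_on X I \<Longrightarrow> A \<in> I \<Longrightarrow> B \<in> I \<Longrightarrow> A \<union> B \<in> I"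
  by (auto simp: ideal_on_def)

lemma ideal_on_finite: "ideal_on X I \<Longrightarrow> A \<subseteq> X \<Longrightarrow> finite A \<Longrightarrow> A \<in> I"
  by (auto simp: ideal_on_def)

lemma ideal_on_proper:
  assumes "ideal_on X I"
  shows "X \<notin> I"
  using assms unfolding ideal_on_def by blast

lemma infinite_orthogonal_if_not_regularization:
  assumes "ideal_on X I" and "A \<subseteq> X" and "A \<notin> regularization X I"
  obtains B where "B \<subseteq> A" and "infinite B" and "\<And>C. C \<in> I \<Longrightarrow> finite (C \<inter> B)"
proof -
  obtain B where B: "B \<subseteq> A" "infinite B" and small: "\<And>C. C \<in> I \<Longrightarrow> C \<subseteq> B \<Longrightarrow> finite C"
    using assms(2,3) by (auto simp: regularization_def)
  have "finite (C \<inter> B)" if "C \<in> I" for C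
    using small[of "C \<inter> B"] ideal_on_subset[OF assms(1) that] by blast
  with B show thesis
    by (rule that)
qed

text \<open>An infinite set orthogonal to \<open>I\<close> can be blown up to the whole of \<open>X\<close> without leaving the
  unary part of the clone, since only finitely many of its points belong to any given member of
  \<open>I\<close>.\<close>

lemma unary_clone_mem_expanding_orthogonal:
  assumes "countable X" and "infinite X" and I: "ideal_on X I"
    and B: "B \<subseteq> X" "infinite B" and orth: "\<And>C. C \<in> I \<Longrightarrow> finite (C \<inter> B)"
  obtains g where "g \<in> ideal_clone_unary X I" and "g ` B = X"
proof -
  have "countable B"
    using B(1) \<open>countable X\<close> by (rule countable_subset)
  then obtain h where h: "bij_betw h B X"
    using bij_betw_trans[OF to_nat_on_infinite bij_betw_from_nat_into] B(2) assms(1,2) by blast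
  obtain c where c: "c \<in> X"
    using \<open>infinite X\<close> by fastforce
  define g where "g = (\<lambda>x\<in>X. if x \<in> B then h x else c)"
  have "g ` B = h ` B"
    using B(1) by (intro image_cong) (auto simp: g_def)
  then have onto: "g ` B = X"
    using h by (simp add: bij_betw_def)
  have maps: "g \<in> X \<rightarrow>\<^sub>E X"
    using h c by (auto simp: g_def bij_betw_def)
  have "g ` C \<in> I" if "C \<in> I" for C
  proof -
    have sub: "C \<subseteq> X"
      using I that by (rule ideal_on_carrier)
    then have "g ` C \<subseteq> insert c (h ` (C \<inter> B))"
      by (auto simp: g_def)
    moreover have "finite (insert c (h ` (C \<inter> B)))"
      using orth[OF that] by simp
    ultimately have "finite (g ` C)"
      by (rule finite_subset)
    moreover have "g ` C \<subseteq> X"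
      using maps sub by auto
    ultimately show ?thesis
      using ideal_on_finite[OF I] by blast
  qed
  moreover have "I \<subseteq> Pow X"
    using ideal_on_carrier[OF I] by blast
  ultimately have "g \<in> ideal_clone_unary X I"
    using maps by (simp add: mem_ideal_clone_unary_iff)
  then show thesis
    using onto by (rule that)
qed

proposition ideal_subset_regularization_if_unary_clone_subset:
  assumes "countable X" and "infinite X" and I: "ideal_on X I" and J: "ideal_on X J"
    and sub: "ideal_clone_unary X I \<subseteq> ideal_clone_unary X J"
  shows "J \<subseteq> regularization X I"
proof (rule subsetI, rule ccontr)
  fix A assume A: "A \<in> J" and "A \<notin> regularization X I"
  moreover have "A \<subseteq> X"
    using J A by (rule ideal_on_carrier)
  ultimately obtain B where B: "B \<subseteq> A" "infinite B" "\<And>C. C \<in> I \<Longrightarrow> finite (C \<inter> B)"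
    using infinite_orthogonal_if_not_regularization[OF I] by blast
  have "B \<subseteq> X"
    using B(1) \<open>A \<subseteq> X\<close> by simp
  then obtain g where g: "g \<in> ideal_clone_unary X I" "g ` B = X"
    using unary_clone_mem_expanding_orthogonal[OF assms(1,2) I _ B(2,3)] by blast
  have "B \<in> J"
    using J A B(1) by (rule ideal_on_subset)
  moreover have "J \<subseteq> Pow X"
    using ideal_on_carrier[OF J] by blast
  ultimately have "g ` B \<in> J"
    using g(1) sub by (auto simp: mem_ideal_clone_unary_iff)
  with g(2) ideal_on_proper[OF J] show False
    by simp
qed

text \<open>The thinning step for a single coordinate. If \<open>h\<close> takes infinitely many values on \<open>T\<close>, then
  infinitely many of these values form a member of \<open>I\<close>, by the definition of the regularization;
  otherwise the finite set of all values is itself a member.\<close>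

lemma infinite_concentrate:
  assumes I: "ideal_on X I" and A: "A \<in> regularization X I"
    and T: "infinite T" and h: "h ` T \<subseteq> A"
  obtains C where "C \<in> I" and "infinite {t \<in> T. h t \<in> C}"
proof (cases "finite (h ` T)")
  case True
  have "A \<subseteq> X"
    using A by (simp add: regularization_def)
  then have "h ` T \<in> I"
    using True h ideal_on_finite[OF I] by blast
  moreover have "{t \<in> T. h t \<in> h ` T} = T"
    by blast
  ultimately show thesis
    using T that[of "h ` T"] by simp
next
  case False
  then obtain C where C: "C \<in> I" "C \<subseteq> h ` T" "infinite C"
    using A h unfolding regularization_def by blast
  have "h ` {t \<in> T. h t \<in> C} = C"
    using C(2) by blast
  with C(3) have "infinite {t \<in> T. h t \<in> C}"
    using finite_imageI[of "{t \<in> T. h t \<in> C}" h] by auto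
  with C(1) show thesis
    by (rule that)
qed

lemma infinite_tuples_concentrate:
  fixes T :: "(nat \<Rightarrow> 'a) set"
  assumes I: "ideal_on X I" and A: "A \<in> regularization X I"
    and T: "infinite T" "T \<subseteq> tuples n A"
  obtains S C where "S \<subseteq> T" and "infinite S" and "C \<in> I" and "S \<subseteq> tuples n C"
proof -
  have "\<exists>S C. S \<subseteq> T \<and> infinite S \<and> C \<in> I \<and> (\<forall>t\<in>S. \<forall>i<k. t i \<in> C)" if "k \<le> n" for k
    using that
  proof (induction k)
    case 0
    have "{} \<in> I"
      using ideal_on_finite[OF I] by simp
    then show ?case
      using T(1) by (intro exI[of _ T] exI[of _ "{}"]) simp
  next
    case (Suc k)
    obtain S C where S: "S \<subseteq> T" "infinite S" and C: "C \<in> I"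
      and entries: "\<forall>t\<in>S. \<forall>i<k. t i \<in> C"
      using Suc.IH[OF Suc_leD[OF Suc.prems]] by blast
    have "t k \<in> A" if "t \<in> S" for t
    proof -
      have "t \<in> tuples n A"
        using that S(1) T(2) by blast
      then show ?thesis
        using Suc.prems by (simp add: tuples_def PiE_iff)
    qed
    then have "(\<lambda>t. t k) ` S \<subseteq> A"
      by blast
    then obtain D where D: "D \<in> I" "infinite {t \<in> S. t k \<in> D}"
      by (rule infinite_concentrate[OF I A S(2)])
    have "C \<union> D \<in> I"
      using I C D(1) by (rule ideal_on_Un)
    moreover have "\<forall>t\<in>{t \<in> S. t k \<in> D}. \<forall>i<Suc k. t i \<in> C \<union> D"
      using entries by (auto simp: less_Suc_eq)
    moreover have "{t \<in> S. t k \<in> D} \<subseteq> T"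
      using S(1) by blast
    ultimately show ?case
      using D(2) by (intro exI conjI)
  qed
  from this[OF order_refl] obtain S C
    where SC: "S \<subseteq> T" "infinite S" "C \<in> I" "\<forall>t\<in>S. \<forall>i<n. t i \<in> C"
    by blast
  have "S \<subseteq> tuples n C"
  proof
    fix t assume t: "t \<in> S"
    then have "t \<in> tuples n A"
      using SC(1) T(2) by blast
    then show "t \<in> tuples n C"
      using t SC(4) by (simp add: tuples_def PiE_iff)
  qed
  with SC(1-3) show thesis
    by (rule that)
qed

proposition ideal_clone_subset_clone_regularization:
  assumes I: "ideal_on X I"
  shows "ideal_clone X I \<subseteq> ideal_clone X (regularization X I)"
proof -
  have "f ` tuples n A \<in> regularization X I"
    if f: "(n, f) \<in> ideal_clone X I" and A: "A \<in> regularization X I" for n f A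
  proof -
    have "A \<subseteq> X"
      using A by (simp add: regularization_def)
    then have "tuples n A \<subseteq> tuples n X"
      unfolding tuples_def by (intro PiE_mono)
    then have "f ` tuples n A \<subseteq> X"
      using f by (auto simp: ideal_clone_def operations_def)
    moreover have "\<exists>C\<in>I. C \<subseteq> B \<and> infinite C"
      if B: "B \<subseteq> f ` tuples n A" "infinite B" for B
    proof -
      obtain T where T: "T \<subseteq> tuples n A" "inj_on f T" "B = f ` T"
        using B(1) unfolding subset_image_inj by blast
      have "infinite T"
        using B(2) T(3) by blast
      then obtain S C where S: "S \<subseteq> T" "infinite S" and C: "C \<in> I" "S \<subseteq> tuples n C"
        using infinite_tuples_concentrate[OF I A _ T(1)] by blast
      have "f ` tuples n C \<in> I"
        using f C(1) by (auto simp: ideal_clone_def)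
      moreover have "f ` S \<subseteq> f ` tuples n C"
        using C(2) by (rule image_mono)
      ultimately have "f ` S \<in> I"
        by (rule ideal_on_subset[OF I])
      moreover have "f ` S \<subseteq> B"
        using S(1) T(3) by blast
      moreover have "infinite (f ` S)"
        using S T(2) by (meson finite_imageD inj_on_subset)
      ultimately show ?thesis
        by blast
    qed
    ultimately show ?thesis
      by (simp add: regularization_def)
  qed
  then show ?thesis
    by (auto simp: ideal_clone_def)
qed

theorem proposition7:
  fixes X :: "'a set" and I J :: "'a set set"
  assumes "countable X" and "infinite X"
    and "ideal_on X I" and "ideal_on X J"
  shows "(ideal_clone_unary X I \<subseteq> ideal_clone_unary X J \<longrightarrow> J \<subseteq> regularization X I) \<and>
         (\<not> dense_ideal X I \<longrightarrow> ideal_clone X I \<subseteq> ideal_clone X (regularization X I))"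
  using ideal_subset_regularization_if_unary_clone_subset[OF assms]
    ideal_clone_subset_clone_regularization[OF assms(3)]
  by blast

end
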